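(* Let $n\ge 1$ be an integer, let $Q_n(8,4)$ and $Q'_n(8,4)$ be respectively the Möbius graph and the cylinder graph of the linear octagonal-quadrilateral network, and put $\mu=15+4\sqrt{14}$, $\nu=15-4\sqrt{14}$. Then $$\mathscr{L}\big(Q_n(8,4)\big)=2n\big(\mu^n+\nu^n+2\big)\qquad\text{and}\qquad \mathscr{L}\big(Q'_n(8,4)\big)=2n\big(\mu^n+\nu^n-2\big).$$
   Context: Both graphs are simple undirected graphs on the $8n$ vertices $1,2,\dots,4n,1',2',\dots,(4n)'$ with $10n$ edges. They share the path edges $\{j,j+1\}$ and $\{j',(j+1)'\}$ for $1\le j\le 4n-1$ and the rungs $\{j,j'\}$ for all $1\le j\le 4n$ with $j\equiv 0$ or $1\pmod 4$. In addition, the Möbius graph $Q_n(8,4)$ has the two twisted closing edges $\{4n,1'\}$ and $\{(4n)',1\}$, while the cylinder graph $Q'_n(8,4)$ has the two untwisted closing edges $\{4n,1\}$ and $\{(4n)',1'\}$. For a connected graph $G$, the complexity $\mathscr{L}(G)$ is the number of spanning trees of $G$. *)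

theory Defs
  imports Complex_Main
begin

text \<open>
  Simple undirected graphs, with edges as two-element sets of vertices.  The AFP entry
  \<open>Graph_Theory\<close> also has a notion of spanning tree, but its forests exclude directed
  cycles only; an undirected edge, encoded as a pair of opposite arcs, already is such a cycle.
\<close>

record 'a ugraph =
  vertices :: "'a set"
  edges :: "'a set set"

definition simple_graph :: "'a ugraph \<Rightarrow> bool" where
  "simple_graph G \<longleftrightarrow>
     finite (vertices G) \<and> (\<forall>e\<in>edges G. e \<subseteq> vertices G \<and> card e = 2)"

definition walk :: "'a ugraph \<Rightarrow> 'a list \<Rightarrow> bool" where
  "walk G p \<longleftrightarrow> p \<noteq> [] \<and> set p \<subseteq> vertices G \<and>
     (\<forall>i. Suc i < length p \<longrightarrow> {p ! i, p ! Suc i} \<in> edges G)"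

definition connected_graph :: "'a ugraph \<Rightarrow> bool" where
  "connected_graph G \<longleftrightarrow> vertices G \<noteq> {} \<and>
     (\<forall>u\<in>vertices G. \<forall>v\<in>vertices G. \<exists>p. walk G p \<and> hd p = u \<and> last p = v)"

text \<open>The first vertex of a cycle is not repeated at the end of the list.\<close>

definition cycle :: "'a ugraph \<Rightarrow> 'a list \<Rightarrow> bool" where
  "cycle G p \<longleftrightarrow> walk G p \<and> distinct p \<and> 3 \<le> length p \<and> {last p, hd p} \<in> edges G"

definition tree :: "'a ugraph \<Rightarrow> bool" where
  "tree G \<longleftrightarrow> simple_graph G \<and> connected_graph G \<and> (\<nexists>p. cycle G p)"

definition spanning_tree :: "'a ugraph \<Rightarrow> 'a ugraph \<Rightarrow> bool" where
  "spanning_tree T G \<longleftrightarrow> tree T \<and> vertices T = vertices G \<and> edges T \<subseteq> edges G"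

definition complexity :: "'a ugraph \<Rightarrow> nat" where
  "complexity G = card {T. spanning_tree T G}"

text \<open>\<open>Plain j\<close> stands for the vertex $j$ and \<open>Primed j\<close> for the vertex $j'$.\<close>

datatype vertex = Plain nat | Primed nat

definition network_vertices :: "nat \<Rightarrow> vertex set" where
  "network_vertices n = Plain ` {1..4*n} \<union> Primed ` {1..4*n}"

definition network_edges :: "nat \<Rightarrow> vertex set set" where
  "network_edges n =
     {{Plain j, Plain (j + 1)} | j. 1 \<le> j \<and> j \<le> 4*n - 1} \<union>
     {{Primed j, Primed (j + 1)} | j. 1 \<le> j \<and> j \<le> 4*n - 1} \<union>
     {{Plain j, Primed j} | j. 1 \<le> j \<and> j \<le> 4*n \<and> (j mod 4 = 0 \<or> j mod 4 = 1)}"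

definition moebius_graph :: "nat \<Rightarrow> vertex ugraph" where
  "moebius_graph n =
     \<lparr>vertices = network_vertices n,
      edges = network_edges n \<union> {{Plain (4*n), Primed 1}, {Primed (4*n), Plain 1}}\<rparr>"

definition cylinder_graph :: "nat \<Rightarrow> vertex ugraph" where
  "cylinder_graph n =
     \<lparr>vertices = network_vertices n,
      edges = network_edges n \<union> {{Plain (4*n), Plain 1}, {Primed (4*n), Primed 1}}\<rparr>"

end

theory Submission
  imports Defs
begin

text \<open>
  The spanning trees are counted by a transfer matrix.  Cut the network open between its last and its
  first column; what remains is a ladder in which some columns lack a rung.  Extending an open ladder
  by a column affects a forest only through the way it connects the four corners of the ladder, so the
  numbers of forests with a given connection pattern of the corners obey a linear recursion
  (\<open>tally_join_last\<close>, \<open>tally_advance_both\<close>).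

  The recursion is solved for every set of rungs at once (\<open>tally_ladder\<close>).  The symmetry exchanging
  the two rails reduces it to the product of 2-by-2 matrices of determinant 1 that describes the
  antisymmetric potentials on the network: each rail step and each rung contributes one elementary
  factor.  Inserting the two closing edges then shows that a closed ladder with \<open>m\<close> columns whose
  product of matrices once around has trace \<open>tr\<close> has \<open>m / 2 * (tr - 2)\<close> spanning trees if the
  closing edges are parallel and \<open>m / 2 * (tr + 2)\<close> if they are crossed
  (\<open>card_spanning_closed_ladder\<close>).

  In the octagonal-quadrilateral network \<open>m = 4 * n\<close>, and the matrix of a period of four columns has
  trace 30 and determinant 1.  Its eigenvalues are the roots \<open>\<mu>\<close> and \<open>\<nu>\<close> of
  \<open>x\<^sup>2 - 30 * x + 1\<close>, so that \<open>tr = \<mu> ^ n + \<nu> ^ n\<close> (\<open>flow_octagonal\<close>).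
\<close>

section \<open>Connectedness and forests of edge sets\<close>

definition conn :: "'a set set \<Rightarrow> 'a \<Rightarrow> 'a \<Rightarrow> bool" where
  "conn F = (\<lambda>x y. {x, y} \<in> F)\<^sup>*\<^sup>*"

text \<open>
  Every edge is a bridge.  Unlike the absence of cyclic walks, this condition is easy to follow
  when a single edge is added (\<open>forest_insert\<close>).
\<close>

definition forest :: "'a set set \<Rightarrow> bool" where
  "forest F \<longleftrightarrow> (\<forall>u v. {u, v} \<in> F \<longrightarrow> \<not> conn (F - {{u, v}}) u v)"

lemma conn_refl [simp]: "conn F x x"
  by (simp add: conn_def)

lemma conn_trans: "conn F x y \<Longrightarrow> conn F y z \<Longrightarrow> conn F x z"
  unfolding conn_def by (rule rtranclp_trans)

lemma conn_edge: "{x, y} \<in> F \<Longrightarrow> conn F x y"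
  unfolding conn_def by (rule r_into_rtranclp)

lemma conn_commute: "conn F x y \<longleftrightarrow> conn F y x"
proof -
  have "symp (\<lambda>x y. {x, y} \<in> F)"
    by (auto simp: symp_def insert_commute)
  then show ?thesis
    unfolding conn_def by (meson symp_def symp_rtranclp)
qed

lemma conn_mono: "F \<subseteq> F' \<Longrightarrow> conn F x y \<Longrightarrow> conn F' x y"
  unfolding conn_def by (rule rtranclp_mono[THEN predicate2D]) auto

text \<open>
  A connection through the new edge needs it at most once, in one of the two directions.
\<close>

lemma conn_insert:
  "conn (insert {u, v} F) x y \<longleftrightarrow>
     conn F x y \<or> conn F x u \<and> conn F v y \<or> conn F x v \<and> conn F u y"
    (is "?L \<longleftrightarrow> ?R x y")
proof
  assume ?L
  then have "(\<lambda>x y. {x, y} \<in> insert {u, v} F)\<^sup>*\<^sup>* x y"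
    by (simp add: conn_def)
  then show "?R x y"
  proof (induction rule: rtranclp_induct)
    case base
    then show ?case by simp
  next
    case (step y z)
    from step.hyps(2) consider "conn F y z" | "y = u" "z = v" | "y = v" "z = u"
      by (auto simp: doubleton_eq_iff intro: conn_edge)
    then show ?case
      using step.IH by cases (auto intro: conn_trans)
  qed
next
  assume "?R x y"
  moreover have "conn (insert {u, v} F) u v" "conn (insert {u, v} F) v u"
    by (auto intro: conn_edge simp: insert_commute)
  moreover have "conn F a b \<Longrightarrow> conn (insert {u, v} F) a b" for a b
    by (erule conn_mono[rotated]) auto
  ultimately show ?L
    by (meson conn_trans)
qed

lemma conn_outside:
  assumes "\<Union>F \<subseteq> V" "v \<notin> V"
  shows "conn F x v \<longleftrightarrow> x = v" "conn F v x \<longleftrightarrow> x = v"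
proof -
  have "conn F v x \<Longrightarrow> x = v" for x
    unfolding conn_def by (erule converse_rtranclpE) (use assms in auto)
  then show "conn F x v \<longleftrightarrow> x = v" "conn F v x \<longleftrightarrow> x = v"
    using conn_commute[of F x v] by auto
qed

lemma forest_empty: "forest {}"
  by (simp add: forest_def)

lemma forest_subset:
  assumes "forest F'" "F \<subseteq> F'"
  shows "forest F"
  unfolding forest_def
proof (intro allI impI notI)
  fix u v assume "{u, v} \<in> F" "conn (F - {{u, v}}) u v"
  then have "{u, v} \<in> F'" "conn (F' - {{u, v}}) u v"
    using assms(2) by (auto elim: conn_mono[rotated])
  then show False
    using assms(1) by (auto simp: forest_def)
qed

text \<open>
  An old edge \<open>{x, y}\<close> that stopped being a bridge would lie on a cycle through the new edge; the
  rest of this cycle would connect \<open>u\<close> to \<open>v\<close> already in \<open>F\<close>.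
\<close>

lemma forest_insert:
  assumes "{u, v} \<notin> F"
  shows "forest (insert {u, v} F) \<longleftrightarrow> forest F \<and> \<not> conn F u v"
proof
  assume L: "forest (insert {u, v} F)"
  then have "\<not> conn (insert {u, v} F - {{u, v}}) u v"
    unfolding forest_def by blast
  moreover have "insert {u, v} F - {{u, v}} = F"
    using assms by auto
  ultimately show "forest F \<and> \<not> conn F u v"
    using forest_subset[OF L] by auto
next
  assume R: "forest F \<and> \<not> conn F u v"
  show "forest (insert {u, v} F)"
    unfolding forest_def
  proof (intro allI impI notI)
    fix x y
    assume e: "{x, y} \<in> insert {u, v} F" and c: "conn (insert {u, v} F - {{x, y}}) x y"
    show False
    proof (cases "{x, y} = {u, v}")
      case True
      then have "conn F x y"
        using c assms by (auto elim: conn_mono[rotated])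
      then show False
        using True R by (auto simp: doubleton_eq_iff conn_commute)
    next
      case False
      let ?F = "F - {{x, y}}"
      have "insert {u, v} F - {{x, y}} = insert {u, v} ?F"
        using False by auto
      then have "conn ?F x y \<or> conn ?F x u \<and> conn ?F v y \<or> conn ?F x v \<and> conn ?F u y"
        using c conn_insert by metis
      moreover have "{x, y} \<in> F"
        using e False by auto
      moreover from this have "\<not> conn ?F x y"
        using R by (auto simp: forest_def)
      moreover have "conn ?F a b \<Longrightarrow> conn F a b" for a b
        by (erule conn_mono[rotated]) auto
      moreover have "conn F x y"
        using \<open>{x, y} \<in> F\<close> by (rule conn_edge)
      ultimately have "conn F u v"
        by (meson conn_commute conn_trans)
      then show False
        using R by simp
    qed
  qed
qed

section \<open>Spanning trees as connected forests\<close>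

lemma walk_conn:
  assumes "walk G p" "i < length p"
  shows "conn (edges G) (p ! 0) (p ! i)"
  using assms(2)
proof (induction i)
  case (Suc i)
  then have "{p ! i, p ! Suc i} \<in> edges G"
    using assms(1) by (auto simp: walk_def)
  with Suc show ?case
    by (auto intro: conn_trans conn_edge)
qed simp

lemma walk_hd_last_conn: "walk G p \<Longrightarrow> conn (edges G) (hd p) (last p)"
  using walk_conn[of G p "length p - 1"]
  by (cases "p = []") (auto simp: walk_def hd_conv_nth last_conv_nth)

text \<open>
  Distinctness, needed for cycles, is kept by cutting the walk at the first visit whenever a step
  returns to a vertex already visited.
\<close>

lemma conn_imp_path:
  assumes "conn F u v" "u \<in> V" "\<Union>F \<subseteq> V"
  shows "\<exists>p. walk \<lparr>vertices = V, edges = F\<rparr> p \<and> distinct p \<and> hd p = u \<and> last p = v"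
  using assms(1) unfolding conn_def
proof (induction rule: rtranclp_induct)
  case base
  have "walk \<lparr>vertices = V, edges = F\<rparr> [u]"
    using assms(2) by (simp add: walk_def)
  then show ?case by force
next
  case (step y z)
  then obtain p where p: "walk \<lparr>vertices = V, edges = F\<rparr> p" "distinct p" "hd p = u" "last p = y"
    by blast
  then have ne: "p \<noteq> []"
    by (simp add: walk_def)
  have z: "z \<in> V"
    using step.hyps(2) assms(3) by auto
  show ?case
  proof (cases "z \<in> set p")
    case True
    then obtain i where i: "i < length p" "p ! i = z"
      by (auto simp: in_set_conv_nth)
    let ?q = "take (Suc i) p"
    have "walk \<lparr>vertices = V, edges = F\<rparr> ?q"
      using p(1) ne i set_take_subset[of "Suc i" p] by (auto simp: walk_def)
    moreover have "distinct ?q" "hd ?q = u"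
      using p by (auto simp: hd_take)
    moreover have "last ?q = z"
      using i by (simp add: take_Suc_conv_app_nth)
    ultimately show ?thesis by blast
  next
    case False
    let ?q = "p @ [z]"
    have edge: "{?q ! i, ?q ! Suc i} \<in> F" if "Suc i < length ?q" for i
    proof (cases "Suc i = length p")
      case True
      then have "p ! i = y"
        using p(4) ne by (simp add: last_conv_nth flip: True)
      with True step.hyps(2) show ?thesis
        by (simp add: nth_append)
    next
      case False
      with that p(1) show ?thesis
        by (auto simp: walk_def nth_append)
    qed
    have "walk \<lparr>vertices = V, edges = F\<rparr> ?q"
      using p(1) z edge by (auto simp: walk_def)
    moreover have "distinct ?q" "hd ?q = u" "last ?q = z"
      using p ne False by auto
    ultimately show ?thesis by blast
  qed
qed

text \<open>
  A cycle minus its closing edge still connects the ends of that edge, so the edge is no bridge.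
  Conversely a path that avoids a non-bridge \<open>{u, v}\<close> but joins its ends has at least three
  vertices, and \<open>{u, v}\<close> closes it to a cycle.
\<close>

lemma acyclic_iff_forest:
  assumes "simple_graph \<lparr>vertices = V, edges = F\<rparr>"
  shows "(\<nexists>p. cycle \<lparr>vertices = V, edges = F\<rparr> p) \<longleftrightarrow> forest F"
proof
  assume nc: "\<nexists>p. cycle \<lparr>vertices = V, edges = F\<rparr> p"
  show "forest F"
    unfolding forest_def
  proof (intro allI impI notI)
    fix u v assume e: "{u, v} \<in> F" and c: "conn (F - {{u, v}}) u v"
    have V: "u \<in> V" "\<Union>(F - {{u, v}}) \<subseteq> V" and "card {u, v} = 2"
      using assms e by (auto simp: simple_graph_def)
    then have "u \<noteq> v" by auto
    obtain p where p: "walk \<lparr>vertices = V, edges = F - {{u, v}}\<rparr> p" "distinct p"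
        "hd p = u" "last p = v"
      using conn_imp_path[OF c V] by blast
    have "length p \<noteq> 0" "length p \<noteq> 1"
      using p \<open>u \<noteq> v\<close> by (auto simp: walk_def length_Suc_conv)
    moreover have "length p \<noteq> 2"
      using p by (auto simp: walk_def length_Suc_conv numeral_2_eq_2)
    ultimately have "3 \<le> length p" by linarith
    moreover have "walk \<lparr>vertices = V, edges = F\<rparr> p"
      using p(1) by (auto simp: walk_def)
    ultimately have "cycle \<lparr>vertices = V, edges = F\<rparr> p"
      using p e by (simp add: cycle_def insert_commute)
    with nc show False by blast
  qed
next
  assume f: "forest F"
  show "\<nexists>p. cycle \<lparr>vertices = V, edges = F\<rparr> p"
  proof
    assume "\<exists>p. cycle \<lparr>vertices = V, edges = F\<rparr> p"
    then obtain p where p: "walk \<lparr>vertices = V, edges = F\<rparr> p" "distinct p" "3 \<le> length p"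
        "{last p, hd p} \<in> F"
      by (auto simp: cycle_def)
    let ?e = "{last p, hd p}"
    \<comment> \<open>Three distinct vertices suffice: no edge of the walk joins its two ends.\<close>
    have "{p ! i, p ! Suc i} \<noteq> ?e" if "Suc i < length p" for i
    proof -
      have "0 < length p"
        using p(3) by linarith
      have hl: "hd p = p ! 0" "last p = p ! (length p - 1)"
        using p by (auto simp: walk_def hd_conv_nth last_conv_nth)
      show ?thesis
        using that p(2,3) \<open>0 < length p\<close> unfolding hl
        by (auto simp: doubleton_eq_iff nth_eq_iff_index_eq)
    qed
    then have "walk \<lparr>vertices = V, edges = F - {?e}\<rparr> p"
      using p(1) by (auto simp: walk_def)
    from walk_hd_last_conn[OF this] have "conn (F - {?e}) (last p) (hd p)"
      by (simp add: conn_commute)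
    then show False
      using f p(4) by (auto simp: forest_def)
  qed
qed

text \<open>
  The forests on \<open>V\<close> in which each component contains a terminal from \<open>T\<close>.  With one terminal
  these are the spanning trees; with more, they are the partial trees from which spanning trees of
  a larger graph attached at the terminals are assembled.
\<close>

definition forests :: "'a set \<Rightarrow> 'a set set \<Rightarrow> 'a set \<Rightarrow> 'a set set set" where
  "forests V E T = {F. F \<subseteq> E \<and> forest F \<and> (\<forall>x\<in>V. \<exists>t\<in>T. conn F x t)}"

lemma tree_iff_forest:
  assumes "simple_graph \<lparr>vertices = V, edges = F\<rparr>" "r \<in> V"
  shows "tree \<lparr>vertices = V, edges = F\<rparr> \<longleftrightarrow> forest F \<and> (\<forall>x\<in>V. conn F x r)"
proof -
  have "\<Union>F \<subseteq> V"
    using assms(1) by (auto simp: simple_graph_def)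
  then have "(\<exists>p. walk \<lparr>vertices = V, edges = F\<rparr> p \<and> hd p = u \<and> last p = v) \<longleftrightarrow> conn F u v"
    if "u \<in> V" for u v
    using conn_imp_path[of F u v V] walk_hd_last_conn[of "\<lparr>vertices = V, edges = F\<rparr>"] that by auto
  then have "connected_graph \<lparr>vertices = V, edges = F\<rparr> \<longleftrightarrow> (\<forall>u\<in>V. \<forall>v\<in>V. conn F u v)"
    using assms(2) by (auto simp: connected_graph_def)
  also have "\<dots> \<longleftrightarrow> (\<forall>x\<in>V. conn F x r)"
    using assms(2) by (meson conn_commute conn_trans)
  finally show ?thesis
    using acyclic_iff_forest[OF assms(1)] assms(1) by (auto simp: tree_def)
qed

lemma complexity_eq_card_forests:
  assumes "simple_graph \<lparr>vertices = V, edges = E\<rparr>" "r \<in> V"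
  shows "complexity \<lparr>vertices = V, edges = E\<rparr> = card (forests V E {r})"
proof -
  have "simple_graph \<lparr>vertices = V, edges = F\<rparr>" if "F \<subseteq> E" for F
    using assms(1) that by (auto simp: simple_graph_def)
  then have iff: "spanning_tree \<lparr>vertices = V, edges = F\<rparr> \<lparr>vertices = V, edges = E\<rparr> \<longleftrightarrow>
      F \<in> forests V E {r}" for F
    using tree_iff_forest[of V F r] assms(2) by (auto simp: spanning_tree_def forests_def)
  have "T = \<lparr>vertices = V, edges = edges T\<rparr>"
    if "spanning_tree T \<lparr>vertices = V, edges = E\<rparr>" for T :: "'a ugraph"
    using that by (simp add: spanning_tree_def)
  then have "{T. spanning_tree T \<lparr>vertices = V, edges = E\<rparr>} =
      (\<lambda>F. \<lparr>vertices = V, edges = F\<rparr>) ` forests V E {r}"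
    using iff by (auto simp: image_iff) metis+
  moreover have "inj_on (\<lambda>F. \<lparr>vertices = V, edges = F\<rparr>) (forests V E {r})"
    by (auto simp: inj_on_def)
  ultimately show ?thesis
    by (simp add: complexity_def card_image)
qed

section \<open>Growing a graph at its terminals\<close>

lemma finite_forests: "finite E \<Longrightarrow> finite (forests V E T)"
  by (rule finite_subset[of _ "Pow E"]) (auto simp: forests_def)

lemma sum_forests_insert_edge:
  fixes h :: "'a set set \<Rightarrow> real"
  assumes "finite E" "{x, y} \<notin> E" "x \<in> T" "y \<in> T"
  shows "(\<Sum>F\<in>forests V (insert {x, y} E) T. h F) =
    (\<Sum>F\<in>forests V E T. h F + (if conn F x y then 0 else h (insert {x, y} F)))"
proof -
  let ?A = "forests V E T" and ?N = "{F \<in> forests V E T. \<not> conn F x y}"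
  have cover: "(\<exists>t\<in>T. conn (insert {x, y} F) z t) \<longleftrightarrow> (\<exists>t\<in>T. conn F z t)" for F z
    using assms(3,4) by (auto simp: conn_insert)
  have split: "forests V (insert {x, y} E) T = ?A \<union> insert {x, y} ` ?N"
  proof (intro set_eqI iffI)
    fix F assume F: "F \<in> forests V (insert {x, y} E) T"
    show "F \<in> ?A \<union> insert {x, y} ` ?N"
    proof (cases "{x, y} \<in> F")
      case True
      define F' where "F' = F - {{x, y}}"
      have eq: "F = insert {x, y} F'" and "{x, y} \<notin> F'"
        using True by (auto simp: F'_def)
      have "F' \<in> ?N"
        using F forest_insert[OF \<open>{x, y} \<notin> F'\<close>] \<open>{x, y} \<notin> F'\<close>
        unfolding eq by (auto simp: forests_def cover)
      then show ?thesis
        using eq by blast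
    qed (use F in \<open>auto simp: forests_def\<close>)
  next
    fix F assume "F \<in> ?A \<union> insert {x, y} ` ?N"
    then show "F \<in> forests V (insert {x, y} E) T"
    proof
      assume "F \<in> insert {x, y} ` ?N"
      then obtain F' where F': "F = insert {x, y} F'" "F' \<in> ?N"
        by blast
      moreover from F' have "{x, y} \<notin> F'"
        using assms(2) by (auto simp: forests_def)
      ultimately show ?thesis
        using forest_insert[of x y F'] by (auto simp: forests_def cover)
    qed (auto simp: forests_def)
  qed
  have "inj_on (insert {x, y}) ?N"
    using assms(2) by (intro inj_onI) (auto simp: forests_def dest!: insert_ident[THEN iffD1, rotated 2])
  then have "(\<Sum>F\<in>insert {x, y} ` ?N. h F) = (\<Sum>F\<in>?N. h (insert {x, y} F))"
    by (simp add: sum.reindex)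
  also have "\<dots> = (\<Sum>F\<in>?A. if conn F x y then 0 else h (insert {x, y} F))"
    by (rule sum.mono_neutral_cong_left) (auto simp: finite_forests assms(1))
  finally show ?thesis
    unfolding split sum.distrib using assms(1,2)
    by (subst sum.union_disjoint) (auto simp: finite_forests forests_def)
qed

text \<open>
  The terminal \<open>c\<close> is replaced by a new vertex \<open>v\<close> hanging on \<open>c\<close>.  If the edge is not chosen,
  the component of \<open>c\<close> must contain another terminal, since no later edge can reach it otherwise.
\<close>

lemma sum_forests_insert_vertex:
  fixes h :: "'a set set \<Rightarrow> real"
  assumes "finite E" "\<Union>E \<subseteq> V" "v \<notin> V" "c \<in> V" "S \<subseteq> V"
  shows "(\<Sum>F\<in>forests (insert v V) (insert {c, v} E) (insert v S). h F) =
    (\<Sum>F\<in>forests V E (insert c S).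
       h (insert {c, v} F) + (if \<exists>t\<in>S. conn F c t then h F else 0))"
proof -
  let ?A = "forests V E (insert c S)" and ?N = "{F \<in> forests V E (insert c S). \<exists>t\<in>S. conn F c t}"
  have new: "{c, v} \<notin> F" "\<And>x. conn F x v \<longleftrightarrow> x = v" "\<And>x. conn F v x \<longleftrightarrow> x = v" if "F \<subseteq> E" for F
  proof -
    have "\<Union>F \<subseteq> V"
      using assms(2) that by auto
    then show "conn F x v \<longleftrightarrow> x = v" "conn F v x \<longleftrightarrow> x = v" for x
      using assms(3) conn_outside[of F V v x] by simp_all
    show "{c, v} \<notin> F"
      using \<open>\<Union>F \<subseteq> V\<close> assms(3) by auto
  qed
  have without: "F \<in> forests (insert v V) (insert {c, v} E) (insert v S) \<longleftrightarrow> F \<in> ?N"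
    if "{c, v} \<notin> F" for F
  proof (cases "F \<subseteq> E")
    case True
    have "(\<forall>x\<in>insert v V. \<exists>t\<in>insert v S. conn F x t) \<longleftrightarrow> (\<forall>x\<in>V. \<exists>t\<in>S. conn F x t)"
      using new(2)[OF True] assms(3) by auto
    also have "\<dots> \<longleftrightarrow> (\<forall>x\<in>V. \<exists>t\<in>insert c S. conn F x t) \<and> (\<exists>t\<in>S. conn F c t)"
      using assms(4) conn_trans[of F _ c] by (metis insert_iff)
    finally have "(\<forall>x\<in>insert v V. \<exists>t\<in>insert v S. conn F x t) \<longleftrightarrow>
        (\<forall>x\<in>V. \<exists>t\<in>insert c S. conn F x t) \<and> (\<exists>t\<in>S. conn F c t)" .
    then show ?thesis
      using True by (auto simp: forests_def)
  qed (use that in \<open>auto simp: forests_def\<close>)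
  have "insert {c, v} F \<in> forests (insert v V) (insert {c, v} E) (insert v S) \<longleftrightarrow> F \<in> ?A"
    if "{c, v} \<notin> F" for F
  proof (cases "F \<subseteq> E")
    case True
    have "(\<exists>t\<in>insert v S. conn (insert {c, v} F) x t) \<longleftrightarrow> (\<exists>t\<in>insert c S. conn F x t)"
      if "x \<in> V" for x
    proof -
      have "x \<noteq> v" "v \<notin> S"
        using that assms(3,5) by auto
      then have "conn (insert {c, v} F) x v \<longleftrightarrow> conn F x c"
        "t \<in> S \<Longrightarrow> conn (insert {c, v} F) x t \<longleftrightarrow> conn F x t" for t
        using new(2,3)[OF True] by (auto simp: conn_insert)
      then show ?thesis
        by auto
    qed
    then have "(\<forall>x\<in>insert v V. \<exists>t\<in>insert v S. conn (insert {c, v} F) x t) \<longleftrightarrow>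
        (\<forall>x\<in>V. \<exists>t\<in>insert c S. conn F x t)"
      by simp
    moreover have "\<not> conn F c v"
      using new[OF True] assms(3,4) by auto
    ultimately show ?thesis
      using True forest_insert[OF that] by (auto simp: forests_def)
  qed (use that in \<open>auto simp: forests_def\<close>)
  note with_edge = this
  have split: "forests (insert v V) (insert {c, v} E) (insert v S) = ?N \<union> insert {c, v} ` ?A"
  proof (intro set_eqI iffI)
    fix F assume F: "F \<in> forests (insert v V) (insert {c, v} E) (insert v S)"
    show "F \<in> ?N \<union> insert {c, v} ` ?A"
    proof (cases "{c, v} \<in> F")
      case True
      then have eq: "F = insert {c, v} (F - {{c, v}})" by auto
      then have "F - {{c, v}} \<in> ?A"
        using with_edge[of "F - {{c, v}}"] F by auto
      with eq show ?thesis by blast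
    qed (use F without in auto)
  next
    fix F assume "F \<in> ?N \<union> insert {c, v} ` ?A"
    then show "F \<in> forests (insert v V) (insert {c, v} E) (insert v S)"
    proof
      assume "F \<in> ?N"
      then show ?thesis
        using without[of F] new(1)[of F] by (auto simp: forests_def)
    next
      assume "F \<in> insert {c, v} ` ?A"
      then obtain F' where "F = insert {c, v} F'" "F' \<in> ?A" by blast
      then show ?thesis
        using with_edge[of F'] new(1)[of F'] by (auto simp: forests_def)
    qed
  qed
  have "inj_on (insert {c, v}) ?A"
    using new(1) by (intro inj_onI) (auto simp: forests_def dest!: insert_ident[THEN iffD1, rotated 2])
  then have "(\<Sum>F\<in>insert {c, v} ` ?A. h F) = (\<Sum>F\<in>?A. h (insert {c, v} F))"
    by (simp add: sum.reindex)
  moreover have "(\<Sum>F\<in>?N. h F) = (\<Sum>F\<in>?A. if \<exists>t\<in>S. conn F c t then h F else 0)"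
    by (rule sum.mono_neutral_cong_left) (auto simp: finite_forests assms(1))
  moreover have "?N \<inter> insert {c, v} ` ?A = {}"
    using new(1) by (auto simp: forests_def)
  ultimately show ?thesis
    unfolding split sum.distrib using assms(1)
    by (subst sum.union_disjoint) (auto simp: finite_forests)
qed

section \<open>Forests sorted by how they connect four terminals\<close>

text \<open>
  How a forest connects the terminals \<open>a\<close>, \<open>b\<close>, \<open>c\<close>, \<open>d\<close> is recorded by six truth values, for
  the pairs \<open>ab\<close>, \<open>ac\<close>, \<open>ad\<close>, \<open>bc\<close>, \<open>bd\<close>, \<open>cd\<close> in this order; only the fifteen value tuples
  coming from set partitions of the terminals occur.
\<close>

type_synonym pattern_weight = "bool \<Rightarrow> bool \<Rightarrow> bool \<Rightarrow> bool \<Rightarrow> bool \<Rightarrow> bool \<Rightarrow> real"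

text \<open>
  The family of numbers of forests with a given pattern, encoded as a linear functional on weights
  \<open>g\<close> of patterns.  A change of the graph then becomes a substitution for \<open>g\<close>, and the terminals
  may coincide.
\<close>

definition tally ::
    "'a set \<Rightarrow> 'a set set \<Rightarrow> 'a \<Rightarrow> 'a \<Rightarrow> 'a \<Rightarrow> 'a \<Rightarrow> pattern_weight \<Rightarrow> real" where
  "tally V E a b c d g = (\<Sum>F\<in>forests V E {a, b, c, d}.
     g (conn F a b) (conn F a c) (conn F a d) (conn F b c) (conn F b d) (conn F c d))"

text \<open>
  Transformations of weights that correspond to a new edge between \<open>c\<close> and \<open>d\<close>, to pushing the
  terminal \<open>c\<close> along a new edge, and to exchanging \<open>c\<close> and \<open>d\<close>.  In the second case the pattern
  stays the same if the edge is chosen; otherwise the new terminal is isolated.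
\<close>

definition join_last :: "pattern_weight \<Rightarrow> pattern_weight" where
  "join_last g = (\<lambda>ab ac ad bc bd cd. g ab ac ad bc bd cd +
     (if cd then 0
      else g (ab \<or> ac \<and> bd \<or> ad \<and> bc) (ac \<or> ad) (ac \<or> ad) (bc \<or> bd) (bc \<or> bd) True))"

definition advance_third :: "pattern_weight \<Rightarrow> pattern_weight" where
  "advance_third g = (\<lambda>ab ac ad bc bd cd. g ab ac ad bc bd cd +
     (if ac \<or> bc \<or> cd then g ab False ad False bd False else 0))"

definition swap_last :: "pattern_weight \<Rightarrow> pattern_weight" where
  "swap_last g = (\<lambda>ab ac ad bc bd cd. g ab ad ac bd bc cd)"

definition advance_both :: "pattern_weight \<Rightarrow> pattern_weight" where
  "advance_both g = advance_third (swap_last (advance_third (swap_last g)))"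

lemma tally_swap_last: "tally V E a b d c g = tally V E a b c d (swap_last g)"
proof -
  have "{a, b, d, c} = {a, b, c, d}" by auto
  then show ?thesis
    by (simp add: tally_def swap_last_def conn_commute[of _ d c])
qed

lemma tally_join_last:
  assumes "finite E" "{c, d} \<notin> E"
  shows "tally V (insert {c, d} E) a b c d g = tally V E a b c d (join_last g)"
proof -
  have "conn (insert {c, d} F) a b \<longleftrightarrow> conn F a b \<or> conn F a c \<and> conn F b d \<or> conn F a d \<and> conn F b c"
    "conn (insert {c, d} F) x c \<longleftrightarrow> conn F x c \<or> conn F x d"
    "conn (insert {c, d} F) x d \<longleftrightarrow> conn F x c \<or> conn F x d"
    "conn (insert {c, d} F) c d" for x F
    by (auto simp: conn_insert conn_commute[of F c b] conn_commute[of F d b])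
  then show ?thesis
    unfolding tally_def by (subst sum_forests_insert_edge) (use assms in \<open>simp_all add: join_last_def cong: if_cong\<close>)
qed

lemma tally_advance_third:
  assumes "finite E" "\<Union>E \<subseteq> V" "v \<notin> V" "a \<in> V" "b \<in> V" "c \<in> V" "d \<in> V"
  shows "tally (insert v V) (insert {c, v} E) a b v d g = tally V E a b c d (advance_third g)"
proof -
  let ?g = "\<lambda>F a b c d. g (conn F a b) (conn F a c) (conn F a d) (conn F b c) (conn F b d) (conn F c d)"
  have sets: "{a, b, v, d} = insert v {a, b, d}" "{a, b, c, d} = insert c {a, b, d}"
    by auto
  have "tally (insert v V) (insert {c, v} E) a b v d g =
    (\<Sum>F\<in>forests V E {a, b, c, d}. ?g (insert {c, v} F) a b v d +
       (if \<exists>t\<in>{a, b, d}. conn F c t then ?g F a b v d else 0))"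
    unfolding tally_def sets by (subst sum_forests_insert_vertex) (use assms in auto)
  also have "\<dots> = tally V E a b c d (advance_third g)"
    unfolding tally_def
  proof (intro sum.cong refl)
    fix F assume "F \<in> forests V E {a, b, c, d}"
    then have "\<Union>F \<subseteq> V"
      using assms(2) by (auto simp: forests_def)
    then have "conn F x v \<longleftrightarrow> x = v" "conn F v x \<longleftrightarrow> x = v" for x
      using assms(3) conn_outside[of F V v x] by simp_all
    moreover have "a \<noteq> v" "b \<noteq> v" "c \<noteq> v" "d \<noteq> v"
      using assms by auto
    ultimately show "?g (insert {c, v} F) a b v d +
        (if \<exists>t\<in>{a, b, d}. conn F c t then ?g F a b v d else 0) =
        advance_third g (conn F a b) (conn F a c) (conn F a d) (conn F b c) (conn F b d) (conn F c d)"
      by (simp add: advance_third_def conn_insert conn_commute[of _ c a] conn_commute[of _ c b])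
  qed
  finally show ?thesis .
qed

lemma tally_advance_both:
  assumes "finite E" "\<Union>E \<subseteq> V" "v \<notin> V" "w \<notin> V" "v \<noteq> w" "a \<in> V" "b \<in> V" "c \<in> V" "d \<in> V"
  shows "tally (insert w (insert v V)) (insert {d, w} (insert {c, v} E)) a b v w g =
    tally V E a b c d (advance_both g)"
proof -
  have "tally (insert w (insert v V)) (insert {d, w} (insert {c, v} E)) a b v w g =
      tally (insert v V) (insert {c, v} E) a b d v (advance_third (swap_last g))"
    unfolding tally_swap_last[of _ _ a b v w]
    using assms by (subst tally_advance_third) auto
  also have "\<dots> = tally V E a b c d (advance_both g)"
    unfolding tally_swap_last[of _ _ a b d v] advance_both_def
    using assms by (subst tally_advance_third) auto
  finally show ?thesis .
qed

section \<open>Open ladders with arbitrary rungs\<close>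

text \<open>
  The index \<open>k\<close> of a ladder is the length of its rails, so that it has \<open>k + 1\<close> columns, numbered
  from 1.  A rung is present in column \<open>j\<close> iff \<open>R j\<close>.
\<close>

definition ladder_vertices :: "nat \<Rightarrow> vertex set" where
  "ladder_vertices k = Plain ` {1..Suc k} \<union> Primed ` {1..Suc k}"

definition rung :: "(nat \<Rightarrow> bool) \<Rightarrow> nat \<Rightarrow> vertex set set" where
  "rung R j = (if R j then {{Plain j, Primed j}} else {})"

primrec ladder :: "(nat \<Rightarrow> bool) \<Rightarrow> nat \<Rightarrow> vertex set set" where
  "ladder R 0 = rung R 1"
| "ladder R (Suc k) = rung R (k + 2) \<union>
     insert {Primed (k + 1), Primed (k + 2)} (insert {Plain (k + 1), Plain (k + 2)} (ladder R k))"

text \<open>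
  Read the ladder as a network of unit resistors with potential \<open>y\<close> on the unprimed vertex of a
  column and \<open>-y\<close> on the primed one, and let \<open>i\<close> be the increase of \<open>y\<close> along the next rail edge.
  A rung is subject to the potential difference \<open>2 * y\<close>; by the current law it changes \<open>i\<close> by this
  amount.  The maps are elementary matrices of determinant 1 acting on \<open>(y, i)\<close>.
\<close>

definition rung_step :: "bool \<Rightarrow> real \<times> real \<Rightarrow> real \<times> real" where
  "rung_step r = (\<lambda>(y, i). (y, if r then i + 2 * y else i))"

definition rail_step :: "real \<times> real \<Rightarrow> real \<times> real" where
  "rail_step = (\<lambda>(y, i). (y + i, i))"

primrec flow :: "(nat \<Rightarrow> bool) \<Rightarrow> real \<times> real \<Rightarrow> nat \<Rightarrow> real \<times> real" where
  "flow R w 0 = rung_step (R 1) w"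
| "flow R w (Suc k) = rung_step (R (k + 2)) (rail_step (flow R w k))"

text \<open>
  The number of forests of the open ladder for each connection pattern of its corners
  \<open>a = 1\<close>, \<open>b = 1'\<close>, \<open>c = k + 1\<close>, \<open>d = (k + 1)'\<close>.  By the all-minors matrix tree theorem these
  numbers come from the response matrix of the network seen at its corners.  The reflection that
  exchanges the rails splits it into a symmetric part, for which no current passes a rung and only
  the rail length \<open>k\<close> matters, and an antisymmetric part, described by the matrix with columns
  \<open>(p, r)\<close> and \<open>(q, s)\<close> that takes \<open>(y, i)\<close> from one end to the other.  This explains why every
  coefficient is linear in \<open>1, p, q, r, s\<close> and in \<open>1, k\<close>, and it suggests the formula; the proof
  below just checks that the formula obeys the recursion.  One of the fifteen patterns
  has no term: in a planar ladder, disjoint components cannot join \<open>a\<close> to \<open>d\<close> and \<open>b\<close> to \<open>c\<close>.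
\<close>

definition ladder_tally :: "real \<Rightarrow> real \<times> real \<Rightarrow> real \<times> real \<Rightarrow> pattern_weight \<Rightarrow> real" where
  "ladder_tally k = (\<lambda>(p, r) (q, s) g.
    (2 * r * g True True True True True True
    + 2 * (p - 1) * (g True True False True False False + g True False True False True False)
    + 2 * (s - 1) * (g False True True False False True + g False False False True True True)
    + (2 - p - s + k * r) * g True False False False False True
    + 4 * g False True False False True False
    + 2 * (k * p - q) * g True False False False False False
    + 2 * (k * s - q) * g False False False False False True
    + 2 * (q + k) * (g False True False False False False + g False False False False True False)
    + 2 * (q - k) * (g False False True False False False + g False False False True False False)
    + 4 * k * q * g False False False False False False) / 4)"

text \<open>
  In this and the following lemma, comparing the coefficients of \<open>g\<close> at each pattern leaves linear
  identities in \<open>p, q, r, s\<close> over polynomials in \<open>k\<close>.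
\<close>

lemma ladder_tally_join_last:
  "ladder_tally k u w (join_last g) = ladder_tally k (rung_step True u) (rung_step True w) g"
  by (cases u; cases w) (simp add: ladder_tally_def join_last_def rung_step_def algebra_simps)

lemma ladder_tally_advance_both:
  "ladder_tally k u w (advance_both g) = ladder_tally (k + 1) (rail_step u) (rail_step w) g"
  by (cases u; cases w)
    (simp add: ladder_tally_def advance_both_def advance_third_def swap_last_def rail_step_def algebra_simps)

lemma finite_ladder: "finite (ladder R k)"
  by (induction k) (auto simp: rung_def)

lemma ladder_vertices_0: "ladder_vertices 0 = {Plain 1, Primed 1}"
  by (auto simp: ladder_vertices_def)

lemma ladder_vertices_Suc:
  "ladder_vertices (Suc k) = insert (Primed (k + 2)) (insert (Plain (k + 2)) (ladder_vertices k))"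
  by (simp add: ladder_vertices_def atLeastAtMostSuc_conv insert_commute)

lemma mem_ladder_vertices [simp]:
  "Plain j \<in> ladder_vertices k \<longleftrightarrow> 1 \<le> j \<and> j \<le> k + 1"
  "Primed j \<in> ladder_vertices k \<longleftrightarrow> 1 \<le> j \<and> j \<le> k + 1"
  by (auto simp: ladder_vertices_def)

lemma ladder_subset: "\<Union>(ladder R k) \<subseteq> ladder_vertices k"
proof (induction k)
  case 0
  show ?case
    by (simp add: rung_def)
next
  case (Suc k)
  then have "\<Union>(ladder R k) \<subseteq> ladder_vertices (Suc k)"
    by (simp add: ladder_vertices_Suc subset_insertI2)
  then show ?case
    by (simp add: rung_def)
qed

lemma tally_add_rung:
  assumes "finite E" "{Plain j, Primed j} \<notin> E"
    and "\<And>g. tally V E a b (Plain j) (Primed j) g = ladder_tally k u w g"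
  shows "tally V (rung R j \<union> E) a b (Plain j) (Primed j) g =
    ladder_tally k (rung_step (R j) u) (rung_step (R j) w) g"
proof (cases "R j")
  case True
  then show ?thesis
    using assms by (simp add: rung_def tally_join_last ladder_tally_join_last)
next
  case False
  then show ?thesis
    using assms by (simp add: rung_def rung_step_def)
qed

text \<open>
  In a ladder with one column both ends coincide, so \<open>a\<close> equals \<open>c\<close> and \<open>b\<close> equals \<open>d\<close>; the
  transfer matrix is the identity.
\<close>

lemma tally_column:
  assumes "a \<noteq> b"
  shows "tally {a, b} {} a b a b g = ladder_tally 0 (1, 0) (0, 1) g"
proof -
  have "conn {} x y \<longleftrightarrow> x = y" for x y :: 'a
    using conn_outside[of "{}" "{}" y x] by auto
  moreover from this have "forests {a, b} {} {a, b, a, b} = {{}}"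
    by (auto simp: forests_def forest_empty)
  ultimately show ?thesis
    using assms by (simp add: tally_def ladder_tally_def)
qed

lemma tally_ladder:
  "tally (ladder_vertices k) (ladder R k) (Plain 1) (Primed 1) (Plain (k + 1)) (Primed (k + 1)) g =
    ladder_tally k (flow R (1, 0) k) (flow R (0, 1) k) g"
proof (induction k arbitrary: g)
  case 0
  show ?case
    using tally_add_rung[of "{}" 1 "{Plain 1, Primed 1}" "Plain 1" "Primed 1" 0 "(1, 0)" "(0, 1)" R g]
      tally_column[of "Plain 1" "Primed 1"]
    by (simp add: ladder_vertices_0)
next
  case (Suc k)
  let ?E = "insert {Primed (k + 1), Primed (k + 2)} (insert {Plain (k + 1), Plain (k + 2)} (ladder R k))"
  have "{Plain (k + 2), Primed (k + 2)} \<notin> ladder R k"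
    using ladder_subset[of R k] by auto
  then have new: "{Plain (k + 2), Primed (k + 2)} \<notin> ?E"
    by (auto simp: doubleton_eq_iff)
  have step: "tally (ladder_vertices (Suc k)) ?E (Plain 1) (Primed 1) (Plain (k + 2)) (Primed (k + 2)) h =
      ladder_tally (real k + 1) (rail_step (flow R (1, 0) k)) (rail_step (flow R (0, 1) k)) h" for h
  proof -
    have "tally (ladder_vertices (Suc k)) ?E (Plain 1) (Primed 1) (Plain (k + 2)) (Primed (k + 2)) h =
        tally (ladder_vertices k) (ladder R k) (Plain 1) (Primed 1) (Plain (k + 1)) (Primed (k + 1))
          (advance_both h)"
      unfolding ladder_vertices_Suc
      by (rule tally_advance_both[OF finite_ladder ladder_subset]) auto
    then show ?thesis
      by (simp only: Suc.IH ladder_tally_advance_both)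
  qed
  have "finite ?E"
    by (simp add: finite_ladder)
  have "tally (ladder_vertices (Suc k)) (rung R (k + 2) \<union> ?E) (Plain 1) (Primed 1)
      (Plain (k + 2)) (Primed (k + 2)) g =
      ladder_tally (real k + 1) (rung_step (R (k + 2)) (rail_step (flow R (1, 0) k)))
        (rung_step (R (k + 2)) (rail_step (flow R (0, 1) k))) g"
    by (rule tally_add_rung[OF \<open>finite ?E\<close> new step])
  then show ?case
    by (simp add: add.commute)
qed

section \<open>Closing the ladder\<close>

text \<open>
  The closing edges run between the pairs \<open>ac\<close>, \<open>bd\<close> or \<open>ad\<close>, \<open>bc\<close>.  Exchanging \<open>a\<close> with \<open>b\<close> and
  \<open>c\<close> with \<open>d\<close> reduces each of them to the pair \<open>ac\<close>.
\<close>

definition swap_first :: "pattern_weight \<Rightarrow> pattern_weight" where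
  "swap_first g = (\<lambda>ab ac ad bc bd cd. g ab bc bd ac ad cd)"

definition join_first_third :: "pattern_weight \<Rightarrow> pattern_weight" where
  "join_first_third g = (\<lambda>ab ac ad bc bd cd. g ab ac ad bc bd cd +
     (if ac then 0
      else g (ab \<or> bc) True (ad \<or> cd) (ab \<or> bc) (bd \<or> ab \<and> cd \<or> bc \<and> ad) (ad \<or> cd)))"

lemma tally_swap_first: "tally V E b a c d g = tally V E a b c d (swap_first g)"
proof -
  have "{b, a, c, d} = {a, b, c, d}" by auto
  then show ?thesis
    by (simp add: tally_def swap_first_def conn_commute[of _ b a])
qed

lemma tally_join_first_third:
  assumes "finite E" "{a, c} \<notin> E"
  shows "tally V (insert {a, c} E) a b c d g = tally V E a b c d (join_first_third g)"
proof -
  have "conn (insert {a, c} F) a b \<longleftrightarrow> conn F a b \<or> conn F b c"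
    "conn (insert {a, c} F) b c \<longleftrightarrow> conn F a b \<or> conn F b c"
    "conn (insert {a, c} F) a d \<longleftrightarrow> conn F a d \<or> conn F c d"
    "conn (insert {a, c} F) c d \<longleftrightarrow> conn F a d \<or> conn F c d"
    "conn (insert {a, c} F) b d \<longleftrightarrow> conn F b d \<or> conn F a b \<and> conn F c d \<or> conn F b c \<and> conn F a d"
    "conn (insert {a, c} F) a c" for F
    by (auto simp: conn_insert conn_commute[of F c b] conn_commute[of F b a])
  then show ?thesis
    unfolding tally_def
    by (subst sum_forests_insert_edge) (use assms in \<open>simp_all add: join_first_third_def cong: if_cong\<close>)
qed

lemma tally_join_first_fourth:
  assumes "finite E" "{a, d} \<notin> E"
  shows "tally V (insert {a, d} E) a b c d g =
    tally V E a b c d (swap_last (join_first_third (swap_last g)))"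
  using tally_join_first_third[OF assms, of V b c "swap_last g"]
  unfolding tally_swap_last[of V _ a b c d, symmetric] tally_swap_last[of V _ a b d c, symmetric] .

lemma tally_join_second_third:
  assumes "finite E" "{b, c} \<notin> E"
  shows "tally V (insert {b, c} E) a b c d g =
    tally V E a b c d (swap_first (join_first_third (swap_first g)))"
  using tally_join_first_third[OF assms, of V a d "swap_first g"]
  unfolding tally_swap_first[of V _ a b c d, symmetric] tally_swap_first[of V _ b a c d, symmetric] .

lemma tally_join_second_fourth:
  assumes "finite E" "{b, d} \<notin> E"
  shows "tally V (insert {b, d} E) a b c d g =
    tally V E a b c d (swap_first (swap_last (join_first_third (swap_last (swap_first g)))))"
  using tally_join_first_fourth[OF assms, of V a c "swap_first g"]
  unfolding tally_swap_first[of V _ a b c d, symmetric] tally_swap_first[of V _ b a c d, symmetric] .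

definition connected_weight :: pattern_weight where
  "connected_weight = (\<lambda>ab ac ad bc bd cd. if ab \<and> ac \<and> ad then 1 else 0)"

lemma card_forests_eq_tally:
  assumes "finite E" "a \<in> V" "b \<in> V" "c \<in> V" "d \<in> V"
  shows "real (card (forests V E {a})) = tally V E a b c d connected_weight"
proof -
  have "(\<forall>x\<in>V. conn F x a) \<longleftrightarrow>
      (\<forall>x\<in>V. \<exists>t\<in>{a, b, c, d}. conn F x t) \<and> conn F a b \<and> conn F a c \<and> conn F a d" for F
  proof
    assume "\<forall>x\<in>V. conn F x a"
    then show "(\<forall>x\<in>V. \<exists>t\<in>{a, b, c, d}. conn F x t) \<and> conn F a b \<and> conn F a c \<and> conn F a d"
      using assms(3-5) conn_commute[of F a] by auto
  next
    assume *: "(\<forall>x\<in>V. \<exists>t\<in>{a, b, c, d}. conn F x t) \<and> conn F a b \<and> conn F a c \<and> conn F a d"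
    then have "conn F t a" if "t \<in> {a, b, c, d}" for t
      using that conn_commute[of F a] by auto
    with * show "\<forall>x\<in>V. conn F x a"
      by (meson conn_trans)
  qed
  then have "forests V E {a} =
      {F \<in> forests V E {a, b, c, d}. conn F a b \<and> conn F a c \<and> conn F a d}"
    by (auto simp: forests_def)
  moreover have "tally V E a b c d connected_weight =
      (\<Sum>F\<in>{F \<in> forests V E {a, b, c, d}. conn F a b \<and> conn F a c \<and> conn F a d}. 1)"
    unfolding tally_def connected_weight_def
    by (rule sum.inter_filter[symmetric]) (simp add: finite_forests assms(1))
  ultimately show ?thesis
    by simp
qed

lemma ladder_eq:
  "ladder R k =
     {{Plain j, Plain (j + 1)} | j. 1 \<le> j \<and> j \<le> k} \<union>
     {{Primed j, Primed (j + 1)} | j. 1 \<le> j \<and> j \<le> k} \<union>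
     {{Plain j, Primed j} | j. 1 \<le> j \<and> j \<le> k + 1 \<and> R j}"
proof (induction k)
  case 0
  have "1 \<le> j \<and> j \<le> 0 + 1 \<and> R j \<longleftrightarrow> j = 1 \<and> R 1" for j
    by auto
  then show ?case
    by (auto simp: rung_def)
next
  case (Suc k)
  have range: "1 \<le> j \<and> j \<le> Suc k \<longleftrightarrow> j = k + 1 \<or> 1 \<le> j \<and> j \<le> k"
    "1 \<le> j \<and> j \<le> Suc k + 1 \<and> R j \<longleftrightarrow> j = k + 2 \<and> R (k + 2) \<or> 1 \<le> j \<and> j \<le> k + 1 \<and> R j" for j
    by (auto simp: le_Suc_eq)
  have split: "{f j | j. j = m \<and> P \<or> Q j} = (if P then {f m} else {}) \<union> {f j | j. Q j}"
    "{f j | j. j = m \<or> Q j} = insert (f m) {f j | j. Q j}"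
    for f :: "nat \<Rightarrow> vertex set" and m P Q
    by auto
  have "k + 1 + 1 = k + 2" by simp
  then show ?case
    unfolding range split ladder.simps Suc.IH rung_def by (simp only: Un_insert_left Un_insert_right) blast
qed

text \<open>
  With \<open>m = k + 1\<close> columns the rails form two cycles of length \<open>m\<close> or one of length \<open>2 * m\<close>,
  and \<open>tr\<close> is the trace of the transfer matrix \<open>M\<close> once around.  In terms of the Laplacian, the
  symmetric potentials see a cycle of length \<open>m\<close>, whose nonzero eigenvalues multiply to \<open>m\<^sup>2\<close>.  The antisymmetric ones return with the
  same sign in the cylinder and with the opposite sign in the Moebius ladder; up to sign their
  determinant is that of \<open>M - 1\<close> or \<open>M + 1\<close>, of absolute value \<open>tr - 2\<close> or \<open>tr + 2\<close> because
  \<open>det M = 1\<close>.  Division by the \<open>2 * m\<close> vertices gives the stated numbers, which are obtained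
  here by evaluating \<open>ladder_tally\<close>.  Having at least three columns keeps the closing edges distinct
  from the rails.
\<close>

lemma card_spanning_closed_ladder:
  fixes R :: "nat \<Rightarrow> bool" and k :: nat
  assumes "2 \<le> k"
  defines "tr \<equiv> fst (rail_step (flow R (1, 0) k)) + snd (rail_step (flow R (0, 1) k))"
  shows
    "real (card (forests (ladder_vertices k)
       (ladder R k \<union> {{Plain (k + 1), Plain 1}, {Primed (k + 1), Primed 1}}) {Plain 1})) =
     real (k + 1) / 2 * (tr - 2)" (is "?cylinder")
    and
    "real (card (forests (ladder_vertices k)
       (ladder R k \<union> {{Plain (k + 1), Primed 1}, {Primed (k + 1), Plain 1}}) {Plain 1})) =
     real (k + 1) / 2 * (tr + 2)" (is "?moebius")
proof -
  let ?V = "ladder_vertices k" and ?L = "ladder R k"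
  let ?a = "Plain 1" and ?b = "Primed 1" and ?c = "Plain (k + 1)" and ?d = "Primed (k + 1)"
  obtain p r q s where flow: "flow R (1, 0) k = (p, r)" "flow R (0, 1) k = (q, s)"
    by (metis surj_pair)
  have tr: "tr = p + r + s"
    by (simp add: tr_def flow rail_step_def)
  have V: "?a \<in> ?V" "?b \<in> ?V" "?c \<in> ?V" "?d \<in> ?V"
    by auto
  have fin: "finite ?L"
    by (rule finite_ladder)
  then have fin': "finite (insert e ?L)" for e
    by simp
  note tally = tally_ladder[of k R, unfolded flow]
  note weights = ladder_tally_def connected_weight_def join_first_third_def swap_first_def swap_last_def
  have ac: "{?a, ?c} \<notin> ?L" and bd: "{?b, ?d} \<notin> insert {?a, ?c} ?L"
    and ad: "{?a, ?d} \<notin> ?L" and bc: "{?b, ?c} \<notin> insert {?a, ?d} ?L"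
    using assms(1) by (auto simp: ladder_eq doubleton_eq_iff)
  have "tally ?V (insert {?b, ?d} (insert {?a, ?c} ?L)) ?a ?b ?c ?d connected_weight =
      real (k + 1) / 2 * (tr - 2)"
    unfolding tally_join_second_fourth[OF fin' bd] tally_join_first_third[OF fin ac] tally tr
    by (simp add: weights field_simps)
  then show ?cylinder
    using card_forests_eq_tally[of "insert {?b, ?d} (insert {?a, ?c} ?L)" ?a ?V ?b ?c ?d] fin V
    by (simp add: insert_commute)
  have "tally ?V (insert {?b, ?c} (insert {?a, ?d} ?L)) ?a ?b ?c ?d connected_weight =
      real (k + 1) / 2 * (tr + 2)"
    unfolding tally_join_second_third[OF fin' bc] tally_join_first_fourth[OF fin ad] tally tr
    by (simp add: weights field_simps)
  then show ?moebius
    using card_forests_eq_tally[of "insert {?b, ?c} (insert {?a, ?d} ?L)" ?a ?V ?b ?c ?d] fin V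
    by (simp add: insert_commute)
qed

section \<open>The octagonal-quadrilateral network\<close>

lemma network_vertices_eq:
  "1 \<le> n \<Longrightarrow> network_vertices n = ladder_vertices (4 * n - 1)"
  by (simp add: network_vertices_def ladder_vertices_def)

definition octagonal_rungs :: "nat \<Rightarrow> bool" where
  "octagonal_rungs j \<longleftrightarrow> j mod 4 = 0 \<or> j mod 4 = 1"

lemma network_edges_eq:
  "1 \<le> n \<Longrightarrow> network_edges n = ladder octagonal_rungs (4 * n - 1)"
  by (simp add: network_edges_def ladder_eq octagonal_rungs_def)

text \<open>
  One period of four columns has the transfer matrix \<open>B\<close> with rows \<open>(23, 10)\<close> and \<open>(16, 7)\<close>, of
  trace 30 and determinant 1, so its eigenvalues are \<open>\<mu>\<close> and \<open>\<nu>\<close>.  The formula is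
  \<open>B ^ n = t * 1 + u * (B - 15)\<close>, where \<open>t\<close> and \<open>u\<close> take the values fitting both eigenvalues; the
  coefficients 8, 10, 16, -8 are the entries of \<open>B - 15\<close>.
\<close>

lemma flow_octagonal:
  fixes n :: nat and \<mu> \<nu> y i :: real
  assumes "1 \<le> n" "\<mu> = 15 + 4 * sqrt 14" "\<nu> = 15 - 4 * sqrt 14"
  defines "t \<equiv> (\<mu> ^ n + \<nu> ^ n) / 2" and "u \<equiv> (\<mu> ^ n - \<nu> ^ n) / (\<mu> - \<nu>)"
  shows "rail_step (flow octagonal_rungs (y, i) (4 * n - 1)) =
    ((t + 8 * u) * y + 10 * u * i, 16 * u * y + (t - 8 * u) * i)"
  using assms(1) unfolding t_def u_def
proof (induction n rule: dec_induct)
  case base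
  have "\<mu> - \<nu> \<noteq> 0" "\<mu> + \<nu> = 30"
    using assms by auto
  moreover have three: "4 * 1 - 1 = Suc (Suc (Suc 0))"
    by simp
  moreover have "octagonal_rungs 1" "\<not> octagonal_rungs (0 + 2)" "\<not> octagonal_rungs (Suc 0 + 2)"
    "octagonal_rungs (Suc (Suc 0) + 2)"
    by (simp_all add: octagonal_rungs_def)
  ultimately show ?case
    unfolding three flow.simps by (simp add: rail_step_def rung_step_def)
next
  case (step n)
  define T U where TU: "T = (\<mu> ^ n + \<nu> ^ n) / 2" "U = (\<mu> ^ n - \<nu> ^ n) / (\<mu> - \<nu>)"
  have diff: "\<mu> - \<nu> = 8 * sqrt 14"
    using assms by simp
  have "224 * (x / (8 * sqrt 14)) = 2 * sqrt 14 * x" for x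
    by (simp add: field_simps)
  moreover have "(\<mu> * x + \<nu> * z) / 2 = 15 * ((x + z) / 2) + 2 * sqrt 14 * (x - z)" for x z
    unfolding assms(2,3) by (simp add: field_simps)
  ultimately have t: "(\<mu> ^ Suc n + \<nu> ^ Suc n) / 2 = 15 * T + 224 * U"
    unfolding TU diff power_Suc by metis
  have split: "\<mu> * x - \<nu> * z = 15 * (x - z) + 4 * sqrt 14 * (x + z)" for x z
    unfolding assms(2,3) by (simp add: algebra_simps)
  have "(\<mu> * x - \<nu> * z) / (8 * sqrt 14) = 15 * ((x - z) / (8 * sqrt 14)) + (x + z) / 2" for x z
    unfolding split add_divide_distrib by simp
  then have u: "(\<mu> ^ Suc n - \<nu> ^ Suc n) / (\<mu> - \<nu>) = 15 * U + T"
    unfolding TU diff power_Suc by metis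
  have four: "4 * Suc n - 1 = Suc (Suc (Suc (Suc (4 * n - 1))))"
    using step.hyps by simp
  have "octagonal_rungs (4 * n - 1 + 2)" "\<not> octagonal_rungs (Suc (4 * n - 1) + 2)"
    "\<not> octagonal_rungs (Suc (Suc (4 * n - 1)) + 2)" "octagonal_rungs (Suc (Suc (Suc (4 * n - 1))) + 2)"
  proof -
    have "4 * n - 1 + 2 = 1 + n * 4" "Suc (4 * n - 1) + 2 = 2 + n * 4"
      "Suc (Suc (4 * n - 1)) + 2 = 3 + n * 4" "Suc (Suc (Suc (4 * n - 1))) + 2 = 4 + n * 4"
      using step.hyps by simp_all
    then show "octagonal_rungs (4 * n - 1 + 2)" "\<not> octagonal_rungs (Suc (4 * n - 1) + 2)"
      "\<not> octagonal_rungs (Suc (Suc (4 * n - 1)) + 2)" "octagonal_rungs (Suc (Suc (Suc (4 * n - 1))) + 2)"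
      unfolding octagonal_rungs_def by (simp_all only: mod_mult_self1) simp_all
  qed
  then have "rail_step (flow octagonal_rungs (y, i) (4 * Suc n - 1)) =
      (rail_step \<circ> rung_step True \<circ> rail_step \<circ> rail_step \<circ> rail_step \<circ> rung_step True)
        (rail_step (flow octagonal_rungs (y, i) (4 * n - 1)))"
    unfolding four flow.simps by (simp add: rung_step_def)
  also have "\<dots> = (let (y, i) = rail_step (flow octagonal_rungs (y, i) (4 * n - 1))
      in (23 * y + 10 * i, 16 * y + 7 * i))"
    by (simp add: rail_step_def rung_step_def split: prod.split)
  finally show ?case
    unfolding step.IH t u TU[symmetric] by (simp add: algebra_simps)
qed

lemma simple_ladder:
  assumes "\<And>e. e \<in> C \<Longrightarrow> e \<subseteq> ladder_vertices k \<and> card e = 2"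
  shows "simple_graph \<lparr>vertices = ladder_vertices k, edges = ladder R k \<union> C\<rparr>"
proof -
  have "card e = 2" if "e \<in> ladder R k" for e
    using that by (induction k) (auto simp: rung_def split: if_splits)
  moreover have "finite (ladder_vertices k)"
    by (simp add: ladder_vertices_def)
  ultimately show ?thesis
    using assms ladder_subset[of R k] by (auto simp: simple_graph_def)
qed

theorem theorem3p4:
  fixes n :: nat and \<mu> \<nu> :: real
  assumes "n \<ge> 1"
    and "\<mu> = 15 + 4 * sqrt 14"
    and "\<nu> = 15 - 4 * sqrt 14"
  shows "real (complexity (moebius_graph n)) = 2 * real n * (\<mu> ^ n + \<nu> ^ n + 2) \<and>
         real (complexity (cylinder_graph n)) = 2 * real n * (\<mu> ^ n + \<nu> ^ n - 2)"
proof -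
  let ?k = "4 * n - 1"
  have k: "?k + 1 = 4 * n" "2 \<le> ?k"
    using assms(1) by simp_all
  have trace: "fst (rail_step (flow octagonal_rungs (1, 0) ?k)) +
      snd (rail_step (flow octagonal_rungs (0, 1) ?k)) = \<mu> ^ n + \<nu> ^ n"
    unfolding flow_octagonal[OF assms] by simp
  have count: "complexity \<lparr>vertices = network_vertices n, edges = network_edges n \<union> {e, e'}\<rparr> =
      card (forests (ladder_vertices ?k) (ladder octagonal_rungs ?k \<union> {e, e'}) {Plain 1})"
    if "e \<subseteq> ladder_vertices ?k \<and> card e = 2" "e' \<subseteq> ladder_vertices ?k \<and> card e' = 2" for e e'
    unfolding network_vertices_eq[OF assms(1)] network_edges_eq[OF assms(1)]
    by (rule complexity_eq_card_forests[OF simple_ladder]) (use that assms(1) in auto)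
  note closed = card_spanning_closed_ladder[OF k(2), of octagonal_rungs, unfolded trace k(1)]
  have "real (complexity (moebius_graph n)) = real (4 * n) / 2 * (\<mu> ^ n + \<nu> ^ n + 2)"
    unfolding moebius_graph_def closed(2)[symmetric]
    by (rule arg_cong[of _ _ real], rule count) (use assms(1) in simp_all)
  moreover have "real (complexity (cylinder_graph n)) = real (4 * n) / 2 * (\<mu> ^ n + \<nu> ^ n - 2)"
    unfolding cylinder_graph_def closed(1)[symmetric]
    by (rule arg_cong[of _ _ real], rule count) (use assms(1) in simp_all)
  ultimately show ?thesis
    by simp
qed

end
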